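(* Let $n\geq 3$ be an integer and suppose $f'(x)=a$ for all $x$, where $a$ is a constant. For $k=3,\ldots,n$ and $\ell=0,1,\ldots,k-3$ let $$\theta^k_\ell:=\binom{n-2}{k-3-\ell}\frac{C_\ell}{2^\ell},\qquad C_\ell=\frac{1}{\ell+1}\binom{2\ell}{\ell}$$ ($C_\ell$ being the $\ell$th Catalan number). Then for every $k=3,\ldots,n$ and every $x\in(0,\omega)$, $$\frac{\psi_{k-1}(x)}{(k-2)!}=\binom{n-2}{k-2}xF(x)^{n-k}+\sum_{\ell=0}^{k-3}(-1)^{\ell}\theta^k_\ell a^{\ell}\frac{F(x)^{n-k+\ell+1}}{f(x)^{2\ell+1}}.$$ Consequently, if $\beta_k(x)$ satisfies $$\beta_k(x)=\frac{\psi_{k-1}(x)}{\binom{n-2}{k-2}(k-2)!\,F(x)^{n-k}},$$ then $$\beta_k(x)=x+\frac{1}{\binom{n-2}{k-2}}\sum_{\ell=0}^{k-3}(-1)^{\ell}\theta^k_\ell a^{\ell}\frac{F(x)^{\ell+1}}{f(x)^{2\ell+1}}.$$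
   Context: $F$ is an increasing distribution function on $[0,\omega]$, $0<\omega<\infty$ (so $F(0)=0$, $F(\omega)=1$), with continuous density $f=F'$ and full support; $f(x)>0$ for $x\in(0,\omega)$. Functions $\psi_t$ are defined by $$\psi_0(x):=\int_0^x yF(y)^{n-2}f(y)\,dy,\qquad \psi_{t+1}(x):=\frac{\psi_t'(x)}{f(x)}\quad\text{for }t=0,1,\ldots$$ on $(0,\omega)$. The convention $F(x)^0=1$ is used. *)

theory Defs
  imports "HOL-Analysis.Analysis"
begin

definition catalan :: "nat \<Rightarrow> real" where
  "catalan l = 1 / (real l + 1) * real ((2 * l) choose l)"

text \<open>Only used for \<open>3 \<le> k\<close> and \<open>l \<le> k - 3\<close>, where the subtraction on \<^typ>\<open>nat\<close> does not
  truncate.\<close>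

definition theta :: "nat \<Rightarrow> nat \<Rightarrow> nat \<Rightarrow> real" where
  "theta n k l = real ((n - 2) choose (k - 3 - l)) * (catalan l / 2 ^ l)"

text \<open>The functions \<open>\<psi>\<^sub>t\<close> live on the open support interval; outside it their values are junk.
  Since \<^const>\<open>deriv\<close> is local, the values on the open interval do not depend on those outside.\<close>

primrec psi :: "nat \<Rightarrow> (real \<Rightarrow> real) \<Rightarrow> (real \<Rightarrow> real) \<Rightarrow> nat \<Rightarrow> real \<Rightarrow> real" where
  "psi n F f 0 = (\<lambda>x. integral {0..x} (\<lambda>y. y * F y ^ (n - 2) * f y))"
| "psi n F f (Suc t) = (\<lambda>x. deriv (psi n F f t) x / f x)"

end

theory Submission
  imports Defs
begin

text \<open>Induction on \<open>k\<close>. Differentiating the summand \<open>F ^ m / f ^ (2 * l + 1)\<close> and dividing by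
  \<open>f\<close> gives \<open>m * F ^ (m - 1) / f ^ (2 * l + 1) - (2 * l + 1) * a * F ^ m / f ^ (2 * l + 3)\<close>, so
  the coefficient of index \<open>l\<close> in step \<open>k + 1\<close> collects contributions of the indices \<open>l\<close> and
  \<open>l - 1\<close> in step \<open>k\<close>. They combine by the Catalan recurrence
  \<open>(l + 1) * C\<^sub>l = 2 * (2 * l - 1) * C\<^bsub>l-1\<^esub>\<close> and by the absorption identity for binomial
  coefficients.\<close>

section \<open>Recurrence for Catalan numbers\<close>

lemma catalan_Suc: "(real l + 2) * catalan (Suc l) = 2 * (2 * real l + 1) * catalan l"
proof -
  have central: "Suc l * (2 * Suc l choose Suc l) = 2 * (2 * l + 1) * (2 * l choose l)"
  proof -
    \<comment> \<open>Absorption is used twice, lowering the upper index by one each time; the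
      symmetry of row \<open>2 * l + 1\<close> between the two uses brings the lower index back to
      \<open>Suc l\<close>.\<close>
    have "Suc l * (2 * Suc l choose Suc l) = Suc (Suc (2 * l)) * (Suc (2 * l) choose l)"
      using Suc_times_binomial_eq[of "Suc (2 * l)" l] by (simp add: mult.commute)
    also have "(Suc (2 * l) choose l) = (Suc (2 * l) choose Suc l)"
      using binomial_symmetric[of l "Suc (2 * l)"] by simp
    also have "Suc (Suc (2 * l)) * \<dots> = 2 * (Suc l * (Suc (2 * l) choose Suc l))"
      by simp
    also have "\<dots> = 2 * (2 * l + 1) * (2 * l choose l)"
      using Suc_times_binomial_eq[of "2 * l" l] by (simp add: mult.commute)
    finally show ?thesis .
  qed
  have "(real l + 1) * real (2 * Suc l choose Suc l)
      = 2 * (2 * real l + 1) * real (2 * l choose l)"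
    using arg_cong[OF central, of real] by (simp add: algebra_simps del: binomial_Suc_Suc mult_Suc_right)
  moreover have "(real l + 2) * catalan (Suc l) = real (2 * Suc l choose Suc l)"
    unfolding catalan_def by (simp add: field_simps del: binomial_Suc_Suc mult_Suc_right)
  moreover have "(real l + 1) * catalan l = real (2 * l choose l)"
    unfolding catalan_def by (simp add: field_simps)
  ultimately have "(real l + 1) * ((real l + 2) * catalan (Suc l))
      = (real l + 1) * (2 * (2 * real l + 1) * catalan l)"
    by (metis mult.left_commute)
  then show ?thesis
    by (simp add: add_nonneg_eq_0_iff)
qed

text \<open>In the paper's notation \<open>N = n - 2\<close> and \<open>j = k - 2\<close>. The summation range \<open>{..<j}\<close> makes
  the case \<open>j = 0\<close>, below the paper's range of \<open>k\<close>, the start of the induction.\<close>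

definition psi_closed ::
    "nat \<Rightarrow> real \<Rightarrow> (real \<Rightarrow> real) \<Rightarrow> (real \<Rightarrow> real) \<Rightarrow> nat \<Rightarrow> real \<Rightarrow> real" where
  "psi_closed N a F f j x =
     real (N choose j) * x * F x ^ (N - j)
     + (\<Sum>l<j. (-1) ^ l * (real (N choose (j - 1 - l)) * (catalan l / 2 ^ l)) * a ^ l
          * (F x ^ (N - j + l + 1) / f x ^ (2 * l + 1)))"

section \<open>Derivative of the closed form\<close>

text \<open>Quotient rule. The factor \<open>f x\<close> is pulled out because \<open>psi\<close>
  divides by it: \<open>f ^ p / f ^ (2 * p + 2)\<close> leaves \<open>1 / f ^ (p + 2)\<close>, and
  pulling out \<open>f x\<close> raises the exponent to \<open>p + 3\<close>.\<close>

lemma has_real_derivative_power_div_power: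
  fixes F f :: "real \<Rightarrow> real"
  assumes F: "(F has_real_derivative f x) (at x)"
    and f: "(f has_real_derivative a) (at x)"
    and fx: "f x \<noteq> 0"
  shows "((\<lambda>x. F x ^ Suc m / f x ^ Suc p) has_real_derivative
    f x * (real (Suc m) * (F x ^ m / f x ^ Suc p)
           - real (Suc p) * a * (F x ^ Suc m / f x ^ (p + 3)))) (at x)"
proof -
  have "((\<lambda>x. F x ^ Suc m / f x ^ Suc p) has_real_derivative
      (real (Suc m) * (F x ^ m * f x) * f x ^ Suc p
        - F x ^ Suc m * (real (Suc p) * (f x ^ p * a))) / (f x ^ Suc p * f x ^ Suc p)) (at x)"
    using DERIV_divide[OF DERIV_power_Suc[OF F, of m] DERIV_power_Suc[OF f, of p]] fx
    by (simp add: mult_ac)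
  moreover have "(real (Suc m) * (F x ^ m * f x) * f x ^ Suc p
        - F x ^ Suc m * (real (Suc p) * (f x ^ p * a))) / (f x ^ Suc p * f x ^ Suc p)
      = f x * (real (Suc m) * (F x ^ m / f x ^ Suc p)
           - real (Suc p) * a * (F x ^ Suc m / f x ^ (p + 3)))"
    using fx by (simp add: field_simps power_add power3_eq_cube)
  ultimately show ?thesis
    by simp
qed

text \<open>Two absorption identities turn both sides into
  \<open>N * (N - 1 choose i)\<close>.\<close>

lemma binomial_Suc_ratio: "real (N - i) * real (N choose i) = real (Suc i) * real (N choose Suc i)"
  using arg_cong[OF trans[OF binomial_absorb_comp binomial_absorption[symmetric]], of real]
  by (simp only: of_nat_mult)

text \<open>The algebra of one differentiation step. Each \<open>G l\<close> is treated as a formal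
  symbol, so only the coefficients have to be matched.\<close>

lemma psi_closed_Suc_coeffs:
  fixes G :: "nat \<Rightarrow> real"
  assumes "j < N"
  defines "c \<equiv> \<lambda>l. catalan l / 2 ^ l"
  shows "real (N choose j) * G 0
      + (\<Sum>l<j. real (N choose (j - 1 - l)) * c l
            * (real (N - j + l + 1) * G l + real (2 * l + 1) * G (Suc l)))
    = real (Suc j) * (\<Sum>l<Suc j. real (N choose (j - l)) * c l * G l)"
proof -
  have c0: "c 0 = 1"
    by (simp add: c_def catalan_def)
  have cS: "(real l + 2) * c (Suc l) = (2 * real l + 1) * c l" for l
    using catalan_Suc[of l] by (simp add: c_def field_simps)
  have "(\<Sum>l<j. real (N choose (j - 1 - l)) * c l * (real (N - j + l + 1) * G l))
      = (\<Sum>l<j. real (j - l) * real (N choose (j - l)) * c l * G l)"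
  proof (rule sum.cong)
    fix l assume "l \<in> {..<j}"
    then have "N - (j - 1 - l) = N - j + l + 1" "Suc (j - 1 - l) = j - l"
      using \<open>j < N\<close> by auto
    with binomial_Suc_ratio[of N "j - 1 - l"]
    have "real (N - j + l + 1) * real (N choose (j - 1 - l)) = real (j - l) * real (N choose (j - l))"
      by metis
    then show "real (N choose (j - 1 - l)) * c l * (real (N - j + l + 1) * G l)
        = real (j - l) * real (N choose (j - l)) * c l * G l"
      by (metis mult.assoc mult.commute)
  qed simp
  \<comment> \<open>The added summand \<open>l = j\<close> vanishes through its factor
    \<open>j - l\<close>.\<close>
  also have "\<dots> = (\<Sum>l<Suc j. real (j - l) * real (N choose (j - l)) * c l * G l)"
    by simp
  finally have main: "(\<Sum>l<j. real (N choose (j - 1 - l)) * c l * (real (N - j + l + 1) * G l))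
      = (\<Sum>l<Suc j. real (j - l) * real (N choose (j - l)) * c l * G l)" .
  have shift: "real (N choose (j - 1 - l)) * c l * (real (2 * l + 1) * G (Suc l))
      = (real (Suc l) + 1) * real (N choose (j - Suc l)) * c (Suc l) * G (Suc l)" for l
  proof -
    have "real (2 * l + 1) * c l = (real (Suc l) + 1) * c (Suc l)"
      using cS[of l] by (simp add: algebra_simps)
    moreover have "j - 1 - l = j - Suc l"
      by simp
    ultimately show ?thesis
      by (metis mult.assoc mult.commute)
  qed
  \<comment> \<open>Since \<open>c 0 = 1\<close>, the isolated term is the summand
    \<open>l = 0\<close> of the reindexed sum.\<close>
  have shifted: "real (N choose j) * G 0
      + (\<Sum>l<j. real (N choose (j - 1 - l)) * c l * (real (2 * l + 1) * G (Suc l)))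
    = (\<Sum>l<Suc j. (real l + 1) * real (N choose (j - l)) * c l * G l)"
    by (simp only: shift sum.lessThan_Suc_shift) (simp add: c0)
  have "real (N choose j) * G 0
      + (\<Sum>l<j. real (N choose (j - 1 - l)) * c l
            * (real (N - j + l + 1) * G l + real (2 * l + 1) * G (Suc l)))
    = (\<Sum>l<Suc j. real (j - l) * real (N choose (j - l)) * c l * G l)
      + (\<Sum>l<Suc j. (real l + 1) * real (N choose (j - l)) * c l * G l)"
    by (simp only: distrib_left sum.distrib main shifted[symmetric] add.left_commute)
  \<comment> \<open>The two weights add up to \<open>(j - l) + (l + 1) = j + 1\<close>, independent
    of \<open>l\<close>.\<close>
  also have "\<dots> = (\<Sum>l<Suc j. real (Suc j) * (real (N choose (j - l)) * c l * G l))"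
    unfolding sum.distrib[symmetric]
    by (rule sum.cong) (auto simp: of_nat_diff algebra_simps)
  finally show ?thesis
    by (simp only: sum_distrib_left)
qed

text \<open>The factor \<open>f x\<close> cancels in the recursion for \<open>psi\<close>; the
  factor \<open>Suc j\<close> turns \<open>fact j\<close> into \<open>fact (Suc j)\<close>.\<close>

lemma psi_closed_has_real_derivative:
  fixes F f :: "real \<Rightarrow> real"
  assumes "j < N"
    and F: "(F has_real_derivative f x) (at x)"
    and f: "(f has_real_derivative a) (at x)"
    and fx: "f x \<noteq> 0"
  shows "(psi_closed N a F f j has_real_derivative
    f x * (real (Suc j) * psi_closed N a F f (Suc j) x)) (at x)"
proof -
  define b where "b l = real (N choose (j - 1 - l)) * (catalan l / 2 ^ l)" for l
  \<comment> \<open>These are the signed terms of step \<open>Suc j\<close>, with the power of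
    \<open>F\<close> already lowered by one.\<close>
  define G where "G l = (-1) ^ l * a ^ l * (F x ^ (N - j + l) / f x ^ (2 * l + 1))" for l
  have x_part: "((\<lambda>x. real (N choose j) * x * F x ^ (N - j)) has_real_derivative
      f x * (real (N choose j) * G 0 + real (Suc j) * real (N choose Suc j) * x * F x ^ (N - Suc j)))
      (at x)"
  proof -
    have "((\<lambda>x. real (N choose j) * x * F x ^ (N - j)) has_real_derivative
        real (N choose j) * F x ^ (N - j)
        + real (N - j) * real (N choose j) * x * (F x ^ (N - Suc j) * f x)) (at x)"
      using F by (auto intro!: derivative_eq_intros simp: algebra_simps)
    \<comment> \<open>What results from differentiating the factor \<open>x\<close> thus joins the
      sum as its isolated \<open>G 0\<close> term.\<close>
    moreover have "F x ^ (N - j) = f x * G 0"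
      using fx by (simp add: G_def)
    ultimately show ?thesis
      unfolding binomial_Suc_ratio by (simp add: algebra_simps)
  qed
  have summand: "((\<lambda>x. (-1) ^ l * b l * a ^ l * (F x ^ (N - j + l + 1) / f x ^ (2 * l + 1)))
      has_real_derivative
      f x * (b l * (real (N - j + l + 1) * G l + real (2 * l + 1) * G (Suc l)))) (at x)" for l
  proof -
    have "((\<lambda>x. F x ^ Suc (N - j + l) / f x ^ Suc (2 * l)) has_real_derivative
      f x * (real (Suc (N - j + l)) * (F x ^ (N - j + l) / f x ^ Suc (2 * l))
           - real (Suc (2 * l)) * a * (F x ^ Suc (N - j + l) / f x ^ (2 * l + 3)))) (at x)"
      using F f fx by (rule has_real_derivative_power_div_power)
    \<comment> \<open>The minus sign and the new factor \<open>a\<close> pass into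
      \<open>G (Suc l)\<close>, whose denominator has exponent \<open>2 * l + 3\<close>.\<close>
    from DERIV_cmult[OF this, of "(-1) ^ l * b l * a ^ l"] show ?thesis
      by (rule DERIV_cong_ev[THEN iffD1, rotated -1])
        (auto simp: G_def algebra_simps eval_nat_numeral)
  qed
  have "(psi_closed N a F f j has_real_derivative
      f x * (real (N choose j) * G 0 + real (Suc j) * real (N choose Suc j) * x * F x ^ (N - Suc j))
      + (\<Sum>l<j. f x * (b l * (real (N - j + l + 1) * G l + real (2 * l + 1) * G (Suc l))))) (at x)"
    unfolding psi_closed_def[abs_def] b_def[symmetric]
    by (intro DERIV_add DERIV_sum x_part summand)
  moreover have "real (Suc j) * psi_closed N a F f (Suc j) x
      = real (Suc j) * real (N choose Suc j) * x * F x ^ (N - Suc j)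
        + real (Suc j) * (\<Sum>l<Suc j. real (N choose (j - l)) * (catalan l / 2 ^ l) * G l)"
  proof -
    have "N - Suc j + l + 1 = N - j + l" for l
      using \<open>j < N\<close> by simp
    then have "(\<Sum>l<Suc j. (-1) ^ l * (real (N choose (Suc j - 1 - l)) * (catalan l / 2 ^ l)) * a ^ l
          * (F x ^ (N - Suc j + l + 1) / f x ^ (2 * l + 1)))
        = (\<Sum>l<Suc j. real (N choose (j - l)) * (catalan l / 2 ^ l) * G l)"
      by (simp only: G_def mult_ac diff_Suc_1 diff_Suc_eq_diff_pred)
    then show ?thesis
      unfolding psi_closed_def by (simp only: distrib_left mult.assoc)
  qed
  ultimately show ?thesis
    using psi_closed_Suc_coeffs[OF \<open>j < N\<close>, of G]
    by (simp only: b_def[symmetric] sum_distrib_left[symmetric] distrib_left[symmetric] add.assoc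
        add.left_commute[of "real (N choose j) * G 0"])
qed

section \<open>Identification of \<open>psi\<close> with the closed form\<close>

text \<open>Fundamental theorem of calculus. The integral starts at 0, where \<open>f\<close> is not
  controlled; but \<open>f\<close> is affine on the open interval, and its affine extension gives an
  integrand \<open>g\<close> continuous on the closed one.\<close>

lemma psi_Suc_0:
  fixes F f :: "real \<Rightarrow> real"
  assumes F: "continuous_on {0..\<omega>} F"
    and f: "\<And>x. x \<in> {0<..<\<omega>} \<Longrightarrow> (f has_real_derivative a) (at x)"
    and x: "x \<in> {0<..<\<omega>}" and fx: "f x \<noteq> 0"
  shows "psi n F f (Suc 0) x = x * F x ^ (n - 2)"
proof -
  have "\<exists>c. \<forall>y\<in>{0<..<\<omega>}. f y - a * y = c"
  proof (rule has_field_derivative_zero_constant)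
    fix y assume "y \<in> {0<..<\<omega>}"
    from f[OF this] show "((\<lambda>y. f y - a * y) has_real_derivative 0) (at y within {0<..<\<omega>})"
      by (auto intro!: derivative_eq_intros intro: DERIV_subset)
  qed (simp add: convex_real_interval)
  then obtain c where c: "\<And>y. y \<in> {0<..<\<omega>} \<Longrightarrow> f y = a * y + c"
    by (metis add.commute diff_add_cancel)
  define g where "g y = y * F y ^ (n - 2) * (a * y + c)" for y
  \<comment> \<open>The factor \<open>y\<close> hides the unspecified value \<open>f 0\<close>.\<close>
  have g_eq: "y * F y ^ (n - 2) * f y = g y" if "y \<in> {0..<\<omega>}" for y
    using that c[of y] by (cases "y = 0") (auto simp: g_def)
  have psi0: "psi n F f 0 y = integral {0..y} g" if "y \<in> {0<..<\<omega>}" for y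
    using that by (auto intro!: integral_cong simp: g_eq)
  have "continuous_on {0..\<omega>} g"
    unfolding g_def by (intro continuous_intros F)
  then have "((\<lambda>y. integral {0..y} g) has_real_derivative g x) (at x within {0..\<omega>})"
    using x by (intro integral_has_real_derivative) auto
  then have "((\<lambda>y. integral {0..y} g) has_real_derivative g x) (at x)"
    using x at_within_Icc_at[of 0 x \<omega>] by simp
  then have "(psi n F f 0 has_real_derivative g x) (at x)"
    by (rule has_field_derivative_transform_within_open[where S = "{0<..<\<omega>}"])
      (use x psi0 in auto)
  then have "deriv (psi n F f 0) x = x * F x ^ (n - 2) * f x"
    using x by (simp only: DERIV_imp_deriv) (simp add: g_eq)
  with fx show ?thesis
    by simp
qed

lemma psi_eq_psi_closed:
  fixes F f :: "real \<Rightarrow> real"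
  assumes contF: "continuous_on {0..\<omega>} F"
    and F: "\<And>x. x \<in> {0<..<\<omega>} \<Longrightarrow> (F has_real_derivative f x) (at x)"
    and f: "\<And>x. x \<in> {0<..<\<omega>} \<Longrightarrow> (f has_real_derivative a) (at x)"
    and f_nz: "\<And>x. x \<in> {0<..<\<omega>} \<Longrightarrow> f x \<noteq> 0"
    and "j \<le> n - 2" "x \<in> {0<..<\<omega>}"
  shows "psi n F f (Suc j) x = fact j * psi_closed (n - 2) a F f j x"
  using assms(5,6)
proof (induction j arbitrary: x)
  case 0
  then show ?case
    using psi_Suc_0[OF contF f] f_nz by (simp add: psi_closed_def del: psi.simps)
next
  case (Suc j)
  have "(psi_closed (n - 2) a F f j has_real_derivative
      f x * (real (Suc j) * psi_closed (n - 2) a F f (Suc j) x)) (at x)"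
    using Suc.prems F f f_nz by (intro psi_closed_has_real_derivative) auto
  then have "((\<lambda>y. fact j * psi_closed (n - 2) a F f j y) has_real_derivative
      fact j * (f x * (real (Suc j) * psi_closed (n - 2) a F f (Suc j) x))) (at x)"
    by (rule DERIV_cmult)
  \<comment> \<open>The induction hypothesis holds on the whole open interval, a neighbourhood of
    \<open>x\<close>, so derivatives may be transferred.\<close>
  then have "(psi n F f (Suc j) has_real_derivative
      fact j * (f x * (real (Suc j) * psi_closed (n - 2) a F f (Suc j) x))) (at x)"
    by (rule has_field_derivative_transform_within_open[where S = "{0<..<\<omega>}"])
      (use Suc in auto)
  then have "deriv (psi n F f (Suc j)) x
      = fact j * (f x * (real (Suc j) * psi_closed (n - 2) a F f (Suc j) x))"
    by (rule DERIV_imp_deriv)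
  then show ?case
    using f_nz[OF Suc.prems(2)] by (simp add: psi.simps(2)[of n F f "Suc j"] del: psi.simps)
qed

theorem lemma2:
  fixes n :: nat and \<omega> a :: real and F f :: "real \<Rightarrow> real" and \<beta> :: "nat \<Rightarrow> real \<Rightarrow> real"
  assumes "n \<ge> 3"
    and "0 < \<omega>"
    and "mono_on {0..\<omega>} F"
    and "continuous_on {0..\<omega>} F"
    and "F 0 = 0" and "F \<omega> = 1"
    and "\<And>x. x \<in> {0<..<\<omega>} \<Longrightarrow> (F has_real_derivative f x) (at x)"
    and "continuous_on {0<..<\<omega>} f"
    and "\<And>x. x \<in> {0<..<\<omega>} \<Longrightarrow> f x > 0"
    and "\<And>x. x \<in> {0<..<\<omega>} \<Longrightarrow> (f has_real_derivative a) (at x)"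
  shows "(\<forall>k\<in>{3..n}. \<forall>x\<in>{0<..<\<omega>}.
            psi n F f (k - 1) x / fact (k - 2) =
              real ((n - 2) choose (k - 2)) * x * F x ^ (n - k)
              + (\<Sum>l=0..k-3. (-1) ^ l * theta n k l * a ^ l
                    * (F x ^ (n - k + l + 1) / f x ^ (2 * l + 1))))
       \<and> (\<forall>k\<in>{3..n}. \<forall>x\<in>{0<..<\<omega>}.
            \<beta> k x = psi n F f (k - 1) x
                      / (real ((n - 2) choose (k - 2)) * fact (k - 2) * F x ^ (n - k))
            \<longrightarrow> \<beta> k x = x + 1 / real ((n - 2) choose (k - 2))
                  * (\<Sum>l=0..k-3. (-1) ^ l * theta n k l * a ^ l
                        * (F x ^ (l + 1) / f x ^ (2 * l + 1))))"
proof -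
  have formula: "psi n F f (k - 1) x / fact (k - 2) =
      real ((n - 2) choose (k - 2)) * x * F x ^ (n - k)
      + (\<Sum>l=0..k-3. (-1) ^ l * theta n k l * a ^ l
            * (F x ^ (n - k + l + 1) / f x ^ (2 * l + 1)))"
    if k: "k \<in> {3..n}" and x: "x \<in> {0<..<\<omega>}" for k x
  proof -
    \<comment> \<open>The closed form is taken at \<open>j = k - 2\<close>; \<open>k \<ge> 3\<close>
      makes its range \<open>{..<j}\<close> equal to \<open>{0..k - 3}\<close>.\<close>
    have "psi n F f (Suc (k - 2)) x = fact (k - 2) * psi_closed (n - 2) a F f (k - 2) x"
      using k assms(9) by (intro psi_eq_psi_closed[OF assms(4,7,10) _ _ x]) force+
    moreover have "Suc (k - 2) = k - 1" "n - 2 - (k - 2) = n - k" "{..<k - 2} = {0..k - 3}"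
        "\<And>l. k - 2 - 1 - l = k - 3 - l"
      using k by auto
    ultimately show ?thesis
      by (simp add: psi_closed_def theta_def)
  qed
  \<comment> \<open>Positivity permits cancelling \<open>F x ^ (n - k)\<close>. It comes from
    \<open>F 0 = 0\<close>, continuity up to 0 and the positive derivative inside.\<close>
  have F_pos: "F x > 0" if "x \<in> {0<..<\<omega>}" for x
  proof -
    have "F 0 < F x"
    proof (rule DERIV_pos_imp_increasing_open[of 0 x F])
      show "continuous_on {0..x} F"
        using assms(4) that by (auto elim: continuous_on_subset)
    qed (use that assms(7,9) in force)+
    then show ?thesis
      using assms(5) by simp
  qed
  have "\<beta> k x = x + 1 / real ((n - 2) choose (k - 2))
      * (\<Sum>l=0..k-3. (-1) ^ l * theta n k l * a ^ l * (F x ^ (l + 1) / f x ^ (2 * l + 1)))"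
    if k: "k \<in> {3..n}" and x: "x \<in> {0<..<\<omega>}"
      and \<beta>: "\<beta> k x = psi n F f (k - 1) x
                  / (real ((n - 2) choose (k - 2)) * fact (k - 2) * F x ^ (n - k))" for k x
  proof -
    let ?B = "real ((n - 2) choose (k - 2))"
      and ?S = "\<Sum>l=0..k-3. (-1) ^ l * theta n k l * a ^ l * (F x ^ (l + 1) / f x ^ (2 * l + 1))"
    have B: "?B \<noteq> 0"
      using k by auto
    have "(\<Sum>l=0..k-3. (-1) ^ l * theta n k l * a ^ l
            * (F x ^ (n - k + l + 1) / f x ^ (2 * l + 1))) = F x ^ (n - k) * ?S"
      unfolding sum_distrib_left by (rule sum.cong) (simp_all add: power_add)
    with formula[OF k x]
    have "psi n F f (k - 1) x / fact (k - 2) = F x ^ (n - k) * (?B * x + ?S)"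
      by (simp add: algebra_simps)
    moreover have "\<beta> k x = psi n F f (k - 1) x / fact (k - 2) / (?B * F x ^ (n - k))"
      using \<beta> by simp
    ultimately have "\<beta> k x = F x ^ (n - k) * (?B * x + ?S) / (?B * F x ^ (n - k))"
      by simp
    also have "\<dots> = (?B * x + ?S) / ?B"
      using F_pos[OF x] by simp
    also have "\<dots> = x + 1 / ?B * ?S"
      using B by (simp only: add_divide_distrib) simp
    finally show ?thesis .
  qed
  with formula show ?thesis
    by blast
qed

end
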